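(* Let $(X,p,E)$ be a lattice-normed vector lattice, $(Y,m,F)$ a lattice-normed vector lattice with an order continuous Banach lattice $(F,\|\cdot\|_F)$, and $(Z,q,G)$ a lattice-normed vector lattice with a Banach lattice $(G,\|\cdot\|_G)$. If $T:X\to Y$ is a sequentially $up$-compact linear operator, $S:Y\to Z$ is a dominated lattice homomorphism, and $I_{S(Y)}$, the ideal of $Z$ generated by $S(Y)$, is $up$-regular in $Z$, then $S\circ T$ is sequentially $up$-compact.
   Context: All vector lattices are real and Archimedean. A net $(x_\alpha)$ in a vector lattice $X$ order converges to $x$ (written $x_\alpha\xrightarrow{o}x$) if there is a net $(y_\beta)_{\beta\in B}$ (possibly with a different index set) with $y_\beta\downarrow 0$ such that for every $\beta$ there is $\alpha_\beta$ with $|x_\alpha-x|\le y_\beta$ for all $\alpha\ge\alpha_\beta$. A lattice-normed vector lattice (LNVL) is a triple $(X,p,E)$ with $X,E$ vector lattices and $p:X\to E_+$ such that $p(x)=0\Leftrightarrow x=0$, $p(\lambda x)=|\lambda|p(x)$, $p(x+y)\le p(x)+p(y)$, and $|x|\le|y|$ implies $p(x)\le p(y)$. A net $x_\alpha$ in $X$ unbounded $p$-converges to $x$ (written $x_\alpha\xrightarrow{up}x$) if $p(|x_\alpha-x|\wedge u)\xrightarrow{o}0$ in $E$ for all $u\in X_+$. A sequence $x_n$ is $p$-bounded if there is $e\in E$ with $p(x_n)\le e$ for all $n$. A linear operator $T:(X,p,E)\to(Y,m,F)$ is sequentially $up$-compact if for every $p$-bounded sequence $x_n$ in $X$ there are a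 subsequence $x_{n_k}$ and $y\in Y$ with $Tx_{n_k}\xrightarrow{up}y$ in $Y$. A linear operator $S:(Y,m,F)\to(Z,q,G)$ is dominated if there is a positive operator $R:F\to G$ with $q(Sy)\le R(m(y))$ for all $y\in Y$. For an LNVL $(Z,q,G)$, a vector sublattice $W\subseteq Z$ (viewed as the LNVL $(W,q|_W,G)$) is $up$-regular in $Z$ if for every net $w_\alpha$ in $W$, $w_\alpha\xrightarrow{up}0$ in $W$ (testing only $u\in W_+$) implies $w_\alpha\xrightarrow{up}0$ in $Z$. *)

theory Defs
  imports "HOL-Analysis.Analysis" "HOL-Library.Lattice_Algebras"
begin

section \<open>Nets\<close>

text \<open>A net is a family \<open>x\<close> indexed by a set \<open>A\<close> that is directed by a preorder \<open>le\<close>.\<close>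

definition directed_set :: "'i set \<Rightarrow> ('i \<Rightarrow> 'i \<Rightarrow> bool) \<Rightarrow> bool" where
  "directed_set A le \<longleftrightarrow>
     A \<noteq> {} \<and>
     (\<forall>a\<in>A. le a a) \<and>
     (\<forall>a\<in>A. \<forall>b\<in>A. \<forall>c\<in>A. le a b \<longrightarrow> le b c \<longrightarrow> le a c) \<and>
     (\<forall>a\<in>A. \<forall>b\<in>A. \<exists>c\<in>A. le a c \<and> le b c)"

definition (in order) decreases_to ::
    "'i set \<Rightarrow> ('i \<Rightarrow> 'i \<Rightarrow> bool) \<Rightarrow> ('i \<Rightarrow> 'a) \<Rightarrow> 'a \<Rightarrow> bool" where
  "decreases_to A le x l \<longleftrightarrow>
     (\<forall>a\<in>A. \<forall>b\<in>A. le a b \<longrightarrow> x b \<le> x a) \<and>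
     (\<forall>a\<in>A. l \<le> x a) \<and>
     (\<forall>z. (\<forall>a\<in>A. z \<le> x a) \<longrightarrow> z \<le> l)"

section \<open>Vector lattices and Banach lattices\<close>

class archimedean_vector_lattice = ordered_real_vector + lattice_ab_group_add_abs +
  assumes archimedean: "0 \<le> x \<Longrightarrow> (\<And>n::nat. real n *\<^sub>R x \<le> y) \<Longrightarrow> x = 0"

class banach_lattice = archimedean_vector_lattice + banach +
  assumes lattice_norm: "\<bar>x\<bar> \<le> \<bar>y\<bar> \<Longrightarrow> norm x \<le> norm y"

text \<open>
  HOL cannot quantify over index types inside a definition.  For a decreasing net only its
  range matters, so nets indexed by subsets of the space itself are fully general here; see
  \<open>order_continuous_norm_any_index\<close> below.
\<close>

class order_continuous_banach_lattice = banach_lattice +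
  assumes order_continuous_norm:
    "directed_set (A :: 'a set) le \<Longrightarrow> decreases_to A le (x :: 'a \<Rightarrow> 'a) 0 \<Longrightarrow> 0 < \<epsilon> \<Longrightarrow>
       \<exists>a\<in>A. \<forall>b\<in>A. le a b \<longrightarrow> norm (x b) < \<epsilon>"

lemma decreasing_net_range:
  fixes y :: "'i \<Rightarrow> 'a::order"
  assumes B: "directed_set B leB" and y: "decreases_to B leB y l"
  shows "directed_set (y ` B) (\<lambda>a b. b \<le> a)" "decreases_to (y ` B) (\<lambda>a b. b \<le> a) (\<lambda>a. a) l"
proof -
  show "directed_set (y ` B) (\<lambda>a b. b \<le> a)"
    unfolding directed_set_def
  proof (intro conjI ballI impI)
    show "y ` B \<noteq> {}" using B unfolding directed_set_def by simp
  next
    fix a b assume "a \<in> y ` B" "b \<in> y ` B"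
    then obtain i j where ij: "i \<in> B" "a = y i" "j \<in> B" "b = y j" by blast
    then obtain k where k: "k \<in> B" "leB i k" "leB j k"
      using B unfolding directed_set_def by blast
    then have "y k \<le> a" "y k \<le> b"
      using y ij unfolding decreases_to_def by simp_all
    then show "\<exists>c\<in>y ` B. c \<le> a \<and> c \<le> b" using k(1) by blast
  next
    fix a :: 'a show "a \<le> a" by (rule order_refl)
  next
    fix a b c :: 'a assume "b \<le> a" "c \<le> b"
    then show "c \<le> a" by (rule order_trans[rotated])
  qed
  show "decreases_to (y ` B) (\<lambda>a b. b \<le> a) (\<lambda>a. a) l"
    using y unfolding decreases_to_def by (simp only: ball_simps) blast
qed

lemma order_continuous_norm_any_index:
  fixes x :: "'i \<Rightarrow> 'a::order_continuous_banach_lattice"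
  assumes A: "directed_set A le" and x: "decreases_to A le x 0" and "0 < \<epsilon>"
  shows "\<exists>a\<in>A. \<forall>b\<in>A. le a b \<longrightarrow> norm (x b) < \<epsilon>"
proof -
  obtain a where a: "a \<in> A" "\<forall>c\<in>x ` A. c \<le> x a \<longrightarrow> norm c < \<epsilon>"
    using order_continuous_norm[OF decreasing_net_range[OF A x] \<open>0 < \<epsilon>\<close>] by auto
  then show ?thesis
    using x unfolding decreases_to_def by blast
qed

section \<open>Order convergence\<close>

text \<open>
  The dominating net is again indexed by a subset of the space itself, without loss of
  generality by \<open>order_converges_any_index\<close>.
\<close>

definition order_converges ::
    "'i set \<Rightarrow> ('i \<Rightarrow> 'i \<Rightarrow> bool) \<Rightarrow> ('i \<Rightarrow> 'a::archimedean_vector_lattice) \<Rightarrow> 'a \<Rightarrow> bool" where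
  "order_converges A le x l \<longleftrightarrow>
     (\<exists>(B :: 'a set) leB (y :: 'a \<Rightarrow> 'a).
        directed_set B leB \<and> decreases_to B leB y 0 \<and>
        (\<forall>b\<in>B. \<exists>a0\<in>A. \<forall>a\<in>A. le a0 a \<longrightarrow> \<bar>x a - l\<bar> \<le> y b))"

lemma order_converges_any_index:
  fixes x :: "'i \<Rightarrow> 'a::archimedean_vector_lattice" and y :: "'j \<Rightarrow> 'a"
  assumes B: "directed_set B leB" and y: "decreases_to B leB y 0"
    and bnd: "\<forall>b\<in>B. \<exists>a0\<in>A. \<forall>a\<in>A. le a0 a \<longrightarrow> \<bar>x a - l\<bar> \<le> y b"
  shows "order_converges A le x l"
proof -
  have "\<forall>c\<in>y ` B. \<exists>a0\<in>A. \<forall>a\<in>A. le a0 a \<longrightarrow> \<bar>x a - l\<bar> \<le> c"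
    using bnd by simp
  then show ?thesis
    unfolding order_converges_def using decreasing_net_range[OF B y] by meson
qed

section \<open>Lattice-normed vector lattices\<close>

definition lattice_normed ::
    "('x::archimedean_vector_lattice \<Rightarrow> 'e::archimedean_vector_lattice) \<Rightarrow> bool" where
  "lattice_normed p \<longleftrightarrow>
     (\<forall>x. 0 \<le> p x) \<and>
     (\<forall>x. p x = 0 \<longleftrightarrow> x = 0) \<and>
     (\<forall>c x. p (c *\<^sub>R x) = \<bar>c\<bar> *\<^sub>R p x) \<and>
     (\<forall>x y. p (x + y) \<le> p x + p y) \<and>
     (\<forall>x y. \<bar>x\<bar> \<le> \<bar>y\<bar> \<longrightarrow> p x \<le> p y)"

text \<open>
  Unbounded \<open>p\<close>-convergence inside a vector sublattice \<open>W\<close> (with the restricted lattice norm):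
  the test elements \<open>u\<close> range over the positive cone of \<open>W\<close> only.
\<close>

definition up_converges_on ::
    "'x set \<Rightarrow> ('x::archimedean_vector_lattice \<Rightarrow> 'e::archimedean_vector_lattice) \<Rightarrow>
     'i set \<Rightarrow> ('i \<Rightarrow> 'i \<Rightarrow> bool) \<Rightarrow> ('i \<Rightarrow> 'x) \<Rightarrow> 'x \<Rightarrow> bool" where
  "up_converges_on W p A le x l \<longleftrightarrow>
     (\<forall>u\<in>W. 0 \<le> u \<longrightarrow> order_converges A le (\<lambda>a. p (inf \<bar>x a - l\<bar> u)) 0)"

abbreviation up_converges ::
    "('x::archimedean_vector_lattice \<Rightarrow> 'e::archimedean_vector_lattice) \<Rightarrow>
     'i set \<Rightarrow> ('i \<Rightarrow> 'i \<Rightarrow> bool) \<Rightarrow> ('i \<Rightarrow> 'x) \<Rightarrow> 'x \<Rightarrow> bool" where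
  "up_converges \<equiv> up_converges_on UNIV"

definition p_bounded ::
    "('x::archimedean_vector_lattice \<Rightarrow> 'e::archimedean_vector_lattice) \<Rightarrow> (nat \<Rightarrow> 'x) \<Rightarrow> bool" where
  "p_bounded p x \<longleftrightarrow> (\<exists>e. \<forall>n. p (x n) \<le> e)"

definition seq_up_compact ::
    "('x::archimedean_vector_lattice \<Rightarrow> 'e::archimedean_vector_lattice) \<Rightarrow>
     ('y::archimedean_vector_lattice \<Rightarrow> 'f::archimedean_vector_lattice) \<Rightarrow> ('x \<Rightarrow> 'y) \<Rightarrow> bool" where
  "seq_up_compact p m T \<longleftrightarrow> linear T \<and>
     (\<forall>x. p_bounded p x \<longrightarrow>
        (\<exists>k y. strict_mono k \<and> up_converges m UNIV (\<le>) (\<lambda>n::nat. T (x (k n))) y))"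

section \<open>Operators, sublattices and ideals\<close>

definition positive_operator ::
    "('f::archimedean_vector_lattice \<Rightarrow> 'g::archimedean_vector_lattice) \<Rightarrow> bool" where
  "positive_operator R \<longleftrightarrow> linear R \<and> (\<forall>x. 0 \<le> x \<longrightarrow> 0 \<le> R x)"

definition dominated_operator ::
    "('y::archimedean_vector_lattice \<Rightarrow> 'f::archimedean_vector_lattice) \<Rightarrow>
     ('z::archimedean_vector_lattice \<Rightarrow> 'g::archimedean_vector_lattice) \<Rightarrow> ('y \<Rightarrow> 'z) \<Rightarrow> bool" where
  "dominated_operator m q S \<longleftrightarrow> linear S \<and>
     (\<exists>R. positive_operator R \<and> (\<forall>y. q (S y) \<le> R (m y)))"

definition lattice_homomorphism ::
    "('y::archimedean_vector_lattice \<Rightarrow> 'z::archimedean_vector_lattice) \<Rightarrow> bool" where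
  "lattice_homomorphism S \<longleftrightarrow> linear S \<and>
     (\<forall>x y. S (sup x y) = sup (S x) (S y)) \<and> (\<forall>x y. S (inf x y) = inf (S x) (S y))"

definition vector_sublattice :: "'z::archimedean_vector_lattice set \<Rightarrow> bool" where
  "vector_sublattice W \<longleftrightarrow> subspace W \<and> (\<forall>x\<in>W. \<forall>y\<in>W. sup x y \<in> W \<and> inf x y \<in> W)"

definition order_ideal :: "'z::archimedean_vector_lattice set \<Rightarrow> bool" where
  "order_ideal I \<longleftrightarrow> subspace I \<and> (\<forall>y\<in>I. \<forall>x. \<bar>x\<bar> \<le> \<bar>y\<bar> \<longrightarrow> x \<in> I)"

definition generated_ideal :: "'z::archimedean_vector_lattice set \<Rightarrow> 'z set" where
  "generated_ideal D = order_ideal hull D"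

text \<open>
  Whether a net \<open>w\<close> in \<open>W\<close> is \<open>up\<close>-null depends only on the sets of values taken on its tails,
  so nets indexed by (point, tail) pairs represent all nets; see \<open>up_regular_any_index\<close>.
\<close>

definition up_regular ::
    "('z::archimedean_vector_lattice \<Rightarrow> 'g::archimedean_vector_lattice) \<Rightarrow> 'z set \<Rightarrow> bool" where
  "up_regular q W \<longleftrightarrow> vector_sublattice W \<and>
     (\<forall>(A :: ('z \<times> 'z set) set) le w.
        directed_set A le \<longrightarrow> (\<forall>a\<in>A. w a \<in> W) \<longrightarrow>
        up_converges_on W q A le w 0 \<longrightarrow> up_converges q A le w 0)"

lemma up_regular_any_index:
  fixes q :: "'z::archimedean_vector_lattice \<Rightarrow> 'g::archimedean_vector_lattice"
    and w :: "'i \<Rightarrow> 'z"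
  assumes reg: "up_regular q W" and A: "directed_set A le" and w: "\<forall>a\<in>A. w a \<in> W"
    and conv: "up_converges_on W q A le w 0"
  shows "up_converges q A le w 0"
proof -
  define tl where "tl a = w ` {b\<in>A. le a b}" for a
  define C where "C = {(z, t). t \<in> tl ` A \<and> z \<in> t}"
  define leC where "leC = (\<lambda>(c :: 'z \<times> 'z set) (d :: 'z \<times> 'z set). snd d \<subseteq> snd c)"
  have dir: "A \<noteq> {}" "\<And>a. a \<in> A \<Longrightarrow> le a a"
    "\<And>a b c. a \<in> A \<Longrightarrow> b \<in> A \<Longrightarrow> c \<in> A \<Longrightarrow> le a b \<Longrightarrow> le b c \<Longrightarrow> le a c"
    "\<And>a b. a \<in> A \<Longrightarrow> b \<in> A \<Longrightarrow> \<exists>c\<in>A. le a c \<and> le b c"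
    using A unfolding directed_set_def by blast+
  have tl_mono: "tl b \<subseteq> tl a" if "a \<in> A" "b \<in> A" "le a b" for a b
    using that dir(3) unfolding tl_def by blast
  have inC: "(w a, tl a) \<in> C" if "a \<in> A" for a
    using that dir(2) unfolding C_def tl_def by blast
  have dirC: "directed_set C leC"
    unfolding directed_set_def
  proof (intro conjI ballI impI)
    show "C \<noteq> {}" using dir(1) inC by blast
  next
    fix c d assume "c \<in> C" "d \<in> C"
    then obtain a b where ab: "a \<in> A" "b \<in> A" "snd c = tl a" "snd d = tl b"
      unfolding C_def by auto
    then obtain e where "e \<in> A" "le a e" "le b e" using dir(4) by blast
    then show "\<exists>e\<in>C. leC c e \<and> leC d e"
      using ab inC tl_mono unfolding leC_def by (metis snd_conv)
  qed (auto simp: leC_def)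
  have tails: "(\<exists>c\<in>C. \<forall>d\<in>C. leC c d \<longrightarrow> P (fst d)) \<longleftrightarrow> (\<exists>a\<in>A. \<forall>b\<in>A. le a b \<longrightarrow> P (w b))" for P
  proof
    assume "\<exists>c\<in>C. \<forall>d\<in>C. leC c d \<longrightarrow> P (fst d)"
    then obtain c where c: "c \<in> C" "\<And>d. d \<in> C \<Longrightarrow> leC c d \<Longrightarrow> P (fst d)" by blast
    then obtain a where a: "a \<in> A" "snd c = tl a" unfolding C_def by auto
    have "P (w b)" if "b \<in> A" "le a b" for b
      using c(2)[OF inC[OF that(1)]] tl_mono[OF a(1) that] a(2) unfolding leC_def by simp
    then show "\<exists>a\<in>A. \<forall>b\<in>A. le a b \<longrightarrow> P (w b)" using a(1) by blast
  next
    assume "\<exists>a\<in>A. \<forall>b\<in>A. le a b \<longrightarrow> P (w b)"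
    then obtain a where a: "a \<in> A" "\<forall>b\<in>A. le a b \<longrightarrow> P (w b)" by blast
    then have "\<forall>z\<in>tl a. P z" unfolding tl_def by blast
    then have "\<forall>d\<in>C. leC (w a, tl a) d \<longrightarrow> P (fst d)"
      unfolding leC_def C_def by auto
    then show "\<exists>c\<in>C. \<forall>d\<in>C. leC c d \<longrightarrow> P (fst d)" using inC[OF a(1)] by blast
  qed
  have eq: "up_converges_on V q C leC fst 0 \<longleftrightarrow> up_converges_on V q A le w 0" for V
    unfolding up_converges_on_def order_converges_def
    by (simp only: tails[of "\<lambda>z. \<bar>q (inf \<bar>z - 0\<bar> u) - 0\<bar> \<le> v" for u v])
  have "\<forall>c\<in>C. fst c \<in> W"
    using w unfolding C_def tl_def by auto
  then show ?thesis
    using reg dirC conv unfolding up_regular_def eq[symmetric] by blast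
qed

end

theory Submission
  imports Defs
begin

text \<open>
  A positive operator \<open>R\<close> on an order continuous Banach lattice maps decreasing null nets to
  decreasing null nets, whatever its target: if \<open>y\<^sub>\<beta> \<down> 0\<close>, pick \<open>\<beta>\<^sub>n\<close> with
  \<open>\<Sum> n \<parallel>y\<^bsub>\<beta>\<^sub>n\<^esub>\<parallel> < \<infinity>\<close> and put \<open>v = \<Sum> n y\<^bsub>\<beta>\<^sub>n\<^esub>\<close>; any lower bound \<open>z\<close> of all \<open>R y\<^sub>\<beta>\<close> satisfies
  \<open>n z \<le> R v\<close> for all \<open>n\<close>, so \<open>z \<le> 0\<close>.  Hence the net dominating
  \<open>m (\<bar>T x\<^sub>k - y\<bar> \<and> \<bar>v\<bar>)\<close> is carried by \<open>R\<close> to one dominating \<open>q (\<bar>S T x\<^sub>k - S y\<bar> \<and> S \<bar>v\<bar>)\<close>.  The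
  elements \<open>S \<bar>v\<bar>\<close> majorise the ideal generated by the range of \<open>S\<close>, and up-regularity
  passes from this ideal to the whole space.
\<close>

text \<open>Both \<open>z\<close> and \<open>- z\<close>, scaled by \<open>\<bar>c\<bar>\<close>,
  stay below the right-hand side; the sign of \<open>c\<close> decides which of the two is
  \<open>c *\<^sub>R z\<close>.\<close>

lemma abs_scaleR_le:
  fixes z :: "'a::archimedean_vector_lattice"
  shows "\<bar>c *\<^sub>R z\<bar> \<le> \<bar>c\<bar> *\<^sub>R \<bar>z\<bar>"
proof -
  have "\<bar>c\<bar> *\<^sub>R z \<le> \<bar>c\<bar> *\<^sub>R \<bar>z\<bar>" "\<bar>c\<bar> *\<^sub>R (- z) \<le> \<bar>c\<bar> *\<^sub>R \<bar>z\<bar>"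
    by (intro scaleR_left_mono abs_ge_self abs_ge_minus_self; simp)+
  then show ?thesis
    by (cases "0 \<le> c") (auto intro!: abs_leI)
qed

text \<open>The positive cone is norm closed: the positive part of \<open>a - v\<close> is dominated
  by \<open>\<bar>s N - v\<bar>\<close>, whose norm tends to 0.\<close>

lemma norm_limit_ge:
  fixes a :: "'a::banach_lattice"
  assumes lim: "s \<longlonglongrightarrow> v" and ge: "eventually (\<lambda>N. a \<le> s N) sequentially"
  shows "a \<le> v"
proof -
  have "eventually (\<lambda>N. norm (sup (a - v) 0) \<le> norm (s N - v)) sequentially"
    using ge
  proof eventually_elim
    case (elim N)
    have "a - v \<le> \<bar>s N - v\<bar>"
      using elim by (meson abs_ge_self diff_right_mono order_trans)
    then have "sup (a - v) 0 \<le> \<bar>s N - v\<bar>" by simp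
    then have "\<bar>sup (a - v) 0\<bar> \<le> \<bar>s N - v\<bar>" by simp
    then show ?case by (rule lattice_norm)
  qed
  moreover have "(\<lambda>N. norm (s N - v)) \<longlonglongrightarrow> 0"
    using lim by (simp add: LIM_zero tendsto_norm_zero)
  ultimately have "norm (sup (a - v) 0) \<le> 0"
    by (metis tendsto_lowerbound trivial_limit_sequentially)
  then have "sup (a - v) 0 = 0" by simp
  then have "a - v \<le> 0" by (metis sup_ge1)
  then show ?thesis by simp
qed

text \<open>Partial sums beyond \<open>n\<close> dominate the single term \<open>f n\<close>, and
  closedness of the cone carries this to the limit.\<close>

lemma le_suminf_of_nonneg:
  fixes f :: "nat \<Rightarrow> 'a::banach_lattice"
  assumes "summable f" and nonneg: "\<And>n. 0 \<le> f n"
  shows "f n \<le> suminf f"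
proof (rule norm_limit_ge[OF summable_LIMSEQ[OF assms(1)]])
  show "eventually (\<lambda>N. f n \<le> sum f {..<N}) sequentially"
    using eventually_gt_at_top[of n]
  proof eventually_elim
    case (elim N)
    then have "sum f {n} \<le> sum f {..<N}"
      by (intro sum_mono2) (auto simp: nonneg)
    then show ?case by simp
  qed
qed

lemma positive_operator_mono:
  assumes "positive_operator R" and "x \<le> y"
  shows "R x \<le> R y"
proof -
  have "0 \<le> R (y - x)" using assms by (simp add: positive_operator_def)
  then show ?thesis using assms(1) by (simp add: positive_operator_def linear_diff)
qed

lemma positive_operator_decreases_to:
  fixes R :: "'f::order_continuous_banach_lattice \<Rightarrow> 'g::archimedean_vector_lattice"
    and y :: "'i \<Rightarrow> 'f"
  assumes R: "positive_operator R" and B: "directed_set B leB" and y: "decreases_to B leB y 0"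
  shows "decreases_to B leB (\<lambda>b. R (y b)) 0"
proof -
  have R_lin: "linear R" and R_pos: "\<And>x. 0 \<le> x \<Longrightarrow> 0 \<le> R x"
    using R by (auto simp: positive_operator_def)
  have y_nonneg: "\<And>b. b \<in> B \<Longrightarrow> 0 \<le> y b"
    using y by (simp add: decreases_to_def)
  have "z \<le> 0" if z: "\<forall>b\<in>B. z \<le> R (y b)" for z
  proof -
    \<comment> \<open>The denominator absorbs the weight \<open>real n\<close> of \<open>f\<close>
      below, leaving a geometric bound; adding 1 keeps it nonzero at \<open>n = 0\<close>.\<close>
    have "\<exists>b\<in>B. norm (y b) < (1/2) ^ n / (real n + 1)" for n
    proof -
      have "0 < (1/2::real) ^ n / (real n + 1)"
        by (simp add: divide_pos_pos add_nonneg_pos)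
      from order_continuous_norm_any_index[OF B y this] show ?thesis
        using B unfolding directed_set_def by blast
    qed
    then obtain b where b: "\<And>n. b n \<in> B"
      and small: "\<And>n. norm (y (b n)) < (1/2) ^ n / (real n + 1)"
      by metis
    define f where "f n = real n *\<^sub>R y (b n)" for n
    have f_nonneg: "0 \<le> f n" for n
      unfolding f_def using y_nonneg[OF b] by (simp add: scaleR_nonneg_nonneg)
    have "norm (f n) \<le> (1/2) ^ n" for n
    proof -
      have "norm (f n) \<le> (real n + 1) * norm (y (b n))"
        unfolding f_def by (simp add: mult_right_mono)
      also have "\<dots> \<le> (1/2) ^ n"
        using small[of n] by (simp add: pos_less_divide_eq add_nonneg_pos mult.commute)
      finally show ?thesis .
    qed
    then have summable: "summable f"
      by (intro summable_comparison_test'[OF summable_geometric[of "1/2::real"], of 0]) auto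
    \<comment> \<open>\<open>archimedean\<close> requires a nonnegative element, so \<open>z\<close>
      is replaced by its positive part, which is still a lower bound because every
      \<open>R (y b)\<close> is nonnegative. The one summand \<open>f n\<close> already supplies the
      factor \<open>n\<close>.\<close>
    have "real n *\<^sub>R sup z 0 \<le> R (suminf f)" for n
    proof -
      have "sup z 0 \<le> R (y (b n))"
        using z b R_pos y_nonneg by simp
      then have "real n *\<^sub>R sup z 0 \<le> real n *\<^sub>R R (y (b n))"
        by (simp add: scaleR_left_mono)
      also have "\<dots> = R (f n)"
        using R_lin by (simp add: f_def linear_scale)
      also have "\<dots> \<le> R (suminf f)"
        by (rule positive_operator_mono[OF R le_suminf_of_nonneg[OF summable f_nonneg]])
      finally show ?thesis .
    qed
    then have "sup z 0 = 0"
      by (intro archimedean[of _ "R (suminf f)"]) simp_all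
    then show ?thesis by (metis sup_ge1)
  qed
  moreover have "R (y b) \<le> R (y a)" if "a \<in> B" "b \<in> B" "leB a b" for a b
    using that y by (intro positive_operator_mono[OF R]) (simp add: decreases_to_def)
  ultimately show ?thesis
    by (simp add: decreases_to_def R_pos y_nonneg)
qed

lemma lattice_homomorphism_abs:
  assumes "lattice_homomorphism S"
  shows "S \<bar>x\<bar> = \<bar>S x\<bar>"
  using assms linear_neg[of S x]
  unfolding lattice_homomorphism_def abs_lattice by metis

text \<open>Majorants are taken of the form \<open>S \<bar>v\<bar>\<close> because these are closed
  under sums and nonnegative multiples: \<open>\<bar>v\<bar> + \<bar>w\<bar>\<close> and
  \<open>\<bar>c\<bar> *\<^sub>R \<bar>v\<bar>\<close> are their own moduli.\<close>

lemma order_ideal_majorised_by_range: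
  assumes S: "lattice_homomorphism S"
  shows "order_ideal {z. \<exists>v. \<bar>z\<bar> \<le> S \<bar>v\<bar>}"
proof -
  have lin: "linear S" using S by (simp add: lattice_homomorphism_def)
  show ?thesis
    unfolding order_ideal_def subspace_def
  proof (intro conjI ballI allI impI)
    show "0 \<in> {z. \<exists>v. \<bar>z\<bar> \<le> S \<bar>v\<bar>}"
      by (auto intro!: exI[of _ 0] simp: linear_0[OF lin])
  next
    fix x y assume "x \<in> {z. \<exists>v. \<bar>z\<bar> \<le> S \<bar>v\<bar>}" "y \<in> {z. \<exists>v. \<bar>z\<bar> \<le> S \<bar>v\<bar>}"
    then obtain v w where "\<bar>x\<bar> \<le> S \<bar>v\<bar>" "\<bar>y\<bar> \<le> S \<bar>w\<bar>" by blast
    then have "\<bar>x + y\<bar> \<le> S (\<bar>v\<bar> + \<bar>w\<bar>)"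
      using order_trans[OF abs_triangle_ineq add_mono] by (simp add: linear_add[OF lin])
    moreover have "\<bar>\<bar>v\<bar> + \<bar>w\<bar>\<bar> = \<bar>v\<bar> + \<bar>w\<bar>" by simp
    ultimately show "x + y \<in> {z. \<exists>v. \<bar>z\<bar> \<le> S \<bar>v\<bar>}"
      by (intro CollectI exI[of _ "\<bar>v\<bar> + \<bar>w\<bar>"]) simp
  next
    fix c x assume "x \<in> {z. \<exists>v. \<bar>z\<bar> \<le> S \<bar>v\<bar>}"
    then obtain v where "\<bar>x\<bar> \<le> S \<bar>v\<bar>" by blast
    then have "\<bar>c\<bar> *\<^sub>R \<bar>x\<bar> \<le> S (\<bar>c\<bar> *\<^sub>R \<bar>v\<bar>)"
      by (simp add: linear_scale[OF lin] scaleR_left_mono)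
    then have "\<bar>c *\<^sub>R x\<bar> \<le> S (\<bar>c\<bar> *\<^sub>R \<bar>v\<bar>)"
      using abs_scaleR_le order_trans by blast
    moreover have "\<bar>\<bar>c\<bar> *\<^sub>R \<bar>v\<bar>\<bar> = \<bar>c\<bar> *\<^sub>R \<bar>v\<bar>" by (simp add: scaleR_nonneg_nonneg)
    ultimately show "c *\<^sub>R x \<in> {z. \<exists>v. \<bar>z\<bar> \<le> S \<bar>v\<bar>}"
      by (intro CollectI exI[of _ "\<bar>c\<bar> *\<^sub>R \<bar>v\<bar>"]) simp
  next
    fix y x assume "y \<in> {z. \<exists>v. \<bar>z\<bar> \<le> S \<bar>v\<bar>}" "\<bar>x\<bar> \<le> \<bar>y\<bar>"
    then show "x \<in> {z. \<exists>v. \<bar>z\<bar> \<le> S \<bar>v\<bar>}" using order_trans by blast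
  qed
qed

text \<open>Since \<open>\<bar>S x\<bar> = S \<bar>x\<bar>\<close>, the majorised elements form an
  ideal containing the range, hence containing the smallest such ideal. This lets
  \<open>S \<bar>v\<bar>\<close> stand in for an arbitrary test element.\<close>

lemma generated_ideal_range_majorised:
  assumes S: "lattice_homomorphism S" and u: "u \<in> generated_ideal (range S)"
  obtains v where "\<bar>u\<bar> \<le> S \<bar>v\<bar>"
proof -
  have "range S \<subseteq> {z. \<exists>v. \<bar>z\<bar> \<le> S \<bar>v\<bar>}"
    using lattice_homomorphism_abs[OF S] by (metis (mono_tags) image_subsetI mem_Collect_eq order_refl)
  then have "generated_ideal (range S) \<subseteq> {z. \<exists>v. \<bar>z\<bar> \<le> S \<bar>v\<bar>}"
    unfolding generated_ideal_def using order_ideal_majorised_by_range[OF S] by (rule hull_minimal)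
  then show thesis using u that by blast
qed

lemma up_converges_on_generated_ideal:
  fixes m :: "'y::archimedean_vector_lattice \<Rightarrow> 'f::order_continuous_banach_lattice"
    and q :: "'z::archimedean_vector_lattice \<Rightarrow> 'g::archimedean_vector_lattice"
  assumes m: "lattice_normed m" and q: "lattice_normed q"
    and dom: "dominated_operator m q S" and S: "lattice_homomorphism S"
    and conv: "up_converges m A le x y"
  shows "up_converges_on (generated_ideal (range S)) q A le (\<lambda>a. S (x a) - S y) 0"
  unfolding up_converges_on_def
proof (intro ballI impI)
  fix u assume u: "u \<in> generated_ideal (range S)" "0 \<le> u"
  obtain R where R: "positive_operator R" "\<And>y. q (S y) \<le> R (m y)"
    using dom by (auto simp: dominated_operator_def)
  obtain v where v: "\<bar>u\<bar> \<le> S \<bar>v\<bar>"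
    using generated_ideal_range_majorised[OF S u(1)] .
  have q_nonneg: "\<And>z. 0 \<le> q z" and q_mono: "\<And>z z'. \<bar>z\<bar> \<le> \<bar>z'\<bar> \<Longrightarrow> q z \<le> q z'"
    using q by (auto simp: lattice_normed_def)
  have m_nonneg: "\<And>z. 0 \<le> m z" using m by (auto simp: lattice_normed_def)
  \<comment> \<open>\<open>S\<close> preserves moduli and infima, so it sends
    \<open>inf \<bar>a - y\<bar> \<bar>v\<bar>\<close> to an infimum with
    \<open>S \<bar>v\<bar>\<close>, which lies above the one with \<open>u\<close>. Monotonicity of
    \<open>q\<close> and domination by \<open>R\<close> then finish.\<close>
  have bound: "q (inf \<bar>S a - S y\<bar> u) \<le> R (m (inf \<bar>a - y\<bar> \<bar>v\<bar>))" for a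
  proof -
    have "\<bar>S a - S y\<bar> = S \<bar>a - y\<bar>"
      using S by (simp add: lattice_homomorphism_abs lattice_homomorphism_def linear_diff)
    moreover have "u \<le> S \<bar>v\<bar>" using v u(2) by simp
    ultimately have "inf \<bar>S a - S y\<bar> u \<le> S (inf \<bar>a - y\<bar> \<bar>v\<bar>)"
      using S by (simp add: lattice_homomorphism_def le_infI2)
    moreover have "0 \<le> inf \<bar>S a - S y\<bar> u" using u(2) by simp
    ultimately have "q (inf \<bar>S a - S y\<bar> u) \<le> q (S (inf \<bar>a - y\<bar> \<bar>v\<bar>))"
      by (intro q_mono) (metis abs_ge_self abs_of_nonneg order_trans)
    then show ?thesis using R(2) order_trans by blast
  qed
  have "order_converges A le (\<lambda>a. m (inf \<bar>x a - y\<bar> \<bar>v\<bar>)) 0"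
    using conv by (simp add: up_converges_on_def)
  then obtain B leB and w :: "'f \<Rightarrow> 'f" where B: "directed_set B leB"
    and w: "decreases_to B leB w 0"
    and tail: "\<forall>b\<in>B. \<exists>a0\<in>A. \<forall>a\<in>A. le a0 a \<longrightarrow> \<bar>m (inf \<bar>x a - y\<bar> \<bar>v\<bar>) - 0\<bar> \<le> w b"
    unfolding order_converges_def by blast
  show "order_converges A le (\<lambda>a. q (inf \<bar>S (x a) - S y - 0\<bar> u)) 0"
  \<comment> \<open>The dominating net \<open>R (w b)\<close> is still indexed by a subset of
    \<open>'f\<close>, whereas \<open>order_converges\<close> in \<open>'g\<close> asks for an index
    set in \<open>'g\<close>.\<close>
  proof (rule order_converges_any_index[OF B positive_operator_decreases_to[OF R(1) B w]], rule ballI)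
    fix b assume "b \<in> B"
    then obtain a0 where a0: "a0 \<in> A" "\<And>a. a \<in> A \<Longrightarrow> le a0 a \<Longrightarrow> m (inf \<bar>x a - y\<bar> \<bar>v\<bar>) \<le> w b"
      using tail by (auto simp: m_nonneg)
    then have "\<bar>q (inf \<bar>S (x a) - S y - 0\<bar> u) - 0\<bar> \<le> R (w b)" if "a \<in> A" "le a0 a" for a
      using bound[of "x a"] positive_operator_mono[OF R(1) a0(2)[OF that]]
      by (simp add: q_nonneg)
    then show "\<exists>a0\<in>A. \<forall>a\<in>A. le a0 a \<longrightarrow> \<bar>q (inf \<bar>S (x a) - S y - 0\<bar> u) - 0\<bar> \<le> R (w b)"
      using a0(1) by blast
  qed
qed

theorem corollary5:
  fixes p :: "'x::archimedean_vector_lattice \<Rightarrow> 'e::archimedean_vector_lattice"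
    and m :: "'y::archimedean_vector_lattice \<Rightarrow> 'f::order_continuous_banach_lattice"
    and q :: "'z::archimedean_vector_lattice \<Rightarrow> 'g::banach_lattice"
    and T :: "'x \<Rightarrow> 'y"
    and S :: "'y \<Rightarrow> 'z"
  assumes "lattice_normed p" and "lattice_normed m" and "lattice_normed q"
    and "seq_up_compact p m T"
    and "dominated_operator m q S" and "lattice_homomorphism S"
    and "up_regular q (generated_ideal (range S))"
  shows "seq_up_compact p q (S \<circ> T)"
  unfolding seq_up_compact_def
proof (intro conjI allI impI)
  have S_lin: "linear S" using assms(6) by (simp add: lattice_homomorphism_def)
  show "linear (S \<circ> T)"
    using assms(4) S_lin by (auto simp: seq_up_compact_def intro: linear_compose)
  fix x :: "nat \<Rightarrow> 'x" assume "p_bounded p x"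
  then obtain k y where k: "strict_mono k"
    and conv: "up_converges m UNIV (\<le>) (\<lambda>n::nat. T (x (k n))) y"
    using assms(4) unfolding seq_up_compact_def by blast
  \<comment> \<open>Up-regularity concerns nets converging to 0, so the limit is subtracted first;
    the differences stay in the range of \<open>S\<close> by linearity.\<close>
  have "S a - S y \<in> generated_ideal (range S)" for a
    unfolding generated_ideal_def by (rule hull_inc) (simp flip: linear_diff[OF S_lin])
  moreover have "directed_set (UNIV :: nat set) (\<le>)"
    unfolding directed_set_def by (auto intro: max.cobounded1 max.cobounded2)
  ultimately have "up_converges q UNIV (\<le>) (\<lambda>n::nat. S (T (x (k n))) - S y) 0"
    by (intro up_regular_any_index[OF assms(7)]
      up_converges_on_generated_ideal[OF assms(2,3,5,6) conv]) simp_all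
  then have "up_converges q UNIV (\<le>) (\<lambda>n::nat. (S \<circ> T) (x (k n))) (S y)"
    by (simp add: up_converges_on_def)
  then show "\<exists>k y. strict_mono k \<and> up_converges q UNIV (\<le>) (\<lambda>n::nat. (S \<circ> T) (x (k n))) y"
    using k by blast
qed

end
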